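(* Let $a\in\mathbb{R}$. The generator of $\mathcal{E}_{]a,\infty[}$ has a spectral gap $\gamma_a^+>0$ if and only if the Hardy inequality \[ \int_{a}^\infty (F(x)-F(a))^2\,dm(x)\leq A\int_a^{\infty} \left(\frac{dF}{dS}\right)^2 dS,\qquad \forall F\in\mathcal{F}, \] holds with some finite constant $A$, i.e. its best constant satisfies $A_a^+<\infty$. In this case, $\gamma_a^+=1/A_a^+$.
   Context: $X=(X_t)_{t\ge 0}$ is a regular linear continuous strong Markov process with state space $\mathbb{R}$ (a one-dimensional diffusion in the sense of Revuz–Yor, Chapter VII), conservative (infinite lifetime) and positively recurrent ($\mathbb{E}_x T_y<\infty$ for all $x,y$, where $T_y=\inf\{t\ge0:X_t=y\}$). $\mathbb{P}_x,\mathbb{E}_x$ denote law and expectation when $X_0=x$. $S$ is a scale function of $X$ (continuous, strictly increasing, with $\mathbb{P}_x[T_b<T_c]=\frac{S(x)-S(c)}{S(b)-S(c)}$ for $c<x<b$), and $m$ is the speed measure associated with $S$, i.e. the Borel measure such that for $c<x<b$ and Borel $f\ge 0$, $\mathbb{E}_x\int_0^{T_c\wedge T_b}f(X_t)\,dt=\int_c^b G(c,b,x,y)f(y)\,dm(y)$, where $G(c,b,x,y)=\frac{(S(b)-S(x\vee y))(S(x\wedge y)-S(c))}{S(b)-S(c)}$. The measure $m$ charges every nonempty open set. By positive recurrence $\lim_{x\to\pm\infty}S(x)=\pm\infty$ and $m(\mathbb{R})<\infty$. $dS$ denotes the Stieltjes measure induced by $S$. For a real function $F$ on $\mathbb{R}$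 write $dF\ll dS$ if there is a locally $dS$-integrable function $f$ with $\int_u^v f\,dS=F(v)-F(u)$ for all $u<v$; then $f$ is denoted $\frac{dF}{dS}$. Let $\mathcal{F}=\{F\in L^2(m):\ dF\ll dS,\ \frac{dF}{dS}\in L^2(dS)\}$. The process $X$ is $m$-symmetric and its Dirichlet form on $L^2(m)$ is $\mathcal{E}(F,F)=\int_{-\infty}^\infty (\frac{dF}{dS})^2 dS$ with domain $\mathcal{F}$. $\mathcal{E}_{]a,\infty[}$ is the restriction of $\mathcal{E}$ to $\mathcal{F}_{]a,\infty[}=\{f\in\mathcal{F}: f(x)=0\ \forall x\le a\}$; it is the Dirichlet form on $L^2(\mathbb{I}_{]a,\infty[}\cdot m)$ of the process $X$ killed when it exits $]a,\infty[$. $A_a^+\in[0,\infty]$ is the infimum of the constants $A\in[0,\infty]$ for which the Hardy inequality in the claim holds ($A=\infty$ is always admissible). Spectral gap: let a Dirichlet form $\mathcal{E}'$ on an $L^2$ space be associated with the non-negative self-adjoint operator $-A'$ ($A'$ is its generator), with spectral family $(E_\xi)_{\xi\ge0}$, so $E_0$ is the orthogonal projection on $\ker A'$. It has a spectral gap at $0$ of width at least $\gamma>0$ iff $\gamma\|f-E_0f\|^2\le\mathcal{E}'(f,f)$ for all $f$ in the domain of $\mathcal{E}'$; the spectral gap is the largest such $\gamma$. *)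

theory Defs
  imports "HOL-Probability.Probability"
begin

section \<open>One-dimensional diffusions on the real line\<close>

definition hitting_time :: "(real \<Rightarrow> 'w \<Rightarrow> real) \<Rightarrow> real \<Rightarrow> 'w \<Rightarrow> ennreal" where
  "hitting_time X y \<omega> = (INF t\<in>{t. 0 \<le> t \<and> X t \<omega> = y}. ennreal t)"

(* The trajectory of the process shifted by r, as an element of the product space over [0,oo).
   For r = T(omega) it is the composition of the path map with the shift operator at time T. *)
definition shifted_path :: "(real \<Rightarrow> 'w \<Rightarrow> real) \<Rightarrow> real \<Rightarrow> 'w \<Rightarrow> real \<Rightarrow> real" where
  "shifted_path X r \<omega> = (\<lambda>s\<in>{0..}. X (r + s) \<omega>)"

(* The process X t is only relevant for t >= 0.  The filtration is indexed by [0,oo], so that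
   stopping times may be infinite; it is right-continuous, i.e. the strong Markov property is
   required at optional times.  X is real-valued at all times, hence conservative. *)
locale continuous_strong_Markov =
  filtration "space M" F
  for M :: "'w measure" and F :: "ennreal \<Rightarrow> 'w measure" +
  fixes P :: "real \<Rightarrow> 'w measure" and X :: "real \<Rightarrow> 'w \<Rightarrow> real"
  assumes sets_F_subset: "sets (F t) \<subseteq> sets M"
    and right_continuous: "t < \<infinity> \<Longrightarrow> (\<Inter>u\<in>{t<..}. sets (F u)) = sets (F t)"
    and adapted: "0 \<le> s \<Longrightarrow> X s \<in> borel_measurable (F (ennreal s))"
    and kernel: "P \<in> borel \<rightarrow>\<^sub>M prob_algebra M"
    and start: "AE \<omega> in P x. X 0 \<omega> = x"
    and continuous_paths: "\<omega> \<in> space M \<Longrightarrow> continuous_on {0..} (\<lambda>t. X t \<omega>)"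
    and strong_Markov:
      "\<lbrakk>stopping_time F T; A \<in> sets (pre_sigma T); B \<in> sets (Pi\<^sub>M {0..} (\<lambda>_. borel))\<rbrakk> \<Longrightarrow>
        emeasure (P x) {\<omega>\<in>A. T \<omega> < \<infinity> \<and> shifted_path X (enn2real (T \<omega>)) \<omega> \<in> B}
        = (\<integral>\<^sup>+\<omega>\<in>{\<omega>\<in>A. T \<omega> < \<infinity>}.
             emeasure (P (X (enn2real (T \<omega>)) \<omega>)) {\<omega>'\<in>space M. shifted_path X 0 \<omega>' \<in> B} \<partial>P x)"

locale regular_diffusion = continuous_strong_Markov M F P X
  for M :: "'w measure" and F :: "ennreal \<Rightarrow> 'w measure"
    and P :: "real \<Rightarrow> 'w measure" and X :: "real \<Rightarrow> 'w \<Rightarrow> real" +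
  assumes regular: "emeasure (P x) {\<omega>\<in>space M. hitting_time X y \<omega> < \<infinity>} > 0"

locale positively_recurrent_diffusion = regular_diffusion M F P X
  for M :: "'w measure" and F :: "ennreal \<Rightarrow> 'w measure"
    and P :: "real \<Rightarrow> 'w measure" and X :: "real \<Rightarrow> 'w \<Rightarrow> real" +
  assumes positively_recurrent: "(\<integral>\<^sup>+\<omega>. hitting_time X y \<omega> \<partial>P x) < \<infinity>"

definition is_scale_function ::
  "(real \<Rightarrow> 'w measure) \<Rightarrow> (real \<Rightarrow> 'w \<Rightarrow> real) \<Rightarrow> (real \<Rightarrow> real) \<Rightarrow> bool" where
  "is_scale_function P X S \<longleftrightarrow> continuous_on UNIV S \<and> strict_mono S \<and>
     (\<forall>c x b. c < x \<and> x < b \<longrightarrow>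
        measure (P x) {\<omega>\<in>space (P x). hitting_time X b \<omega> < hitting_time X c \<omega>}
        = (S x - S c) / (S b - S c))"

definition green :: "(real \<Rightarrow> real) \<Rightarrow> real \<Rightarrow> real \<Rightarrow> real \<Rightarrow> real \<Rightarrow> real" where
  "green S c b x y = (S b - S (max x y)) * (S (min x y) - S c) / (S b - S c)"

definition is_speed_measure ::
  "(real \<Rightarrow> 'w measure) \<Rightarrow> (real \<Rightarrow> 'w \<Rightarrow> real) \<Rightarrow> (real \<Rightarrow> real) \<Rightarrow> real measure \<Rightarrow> bool" where
  "is_speed_measure P X S m \<longleftrightarrow> sets m = sets borel \<and>
     (\<forall>c x b. \<forall>f\<in>borel_measurable borel. c < x \<and> x < b \<longrightarrow>
        (\<integral>\<^sup>+\<omega>. (\<integral>\<^sup>+t\<in>{t. 0 \<le> t \<and> ennreal t < min (hitting_time X c \<omega>) (hitting_time X b \<omega>)}.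
            f (X t \<omega>) \<partial>lborel) \<partial>P x)
        = (\<integral>\<^sup>+y\<in>{c<..<b}. ennreal (green S c b x y) * f y \<partial>m))"

section \<open>Symmetric forms, generators and spectral gaps\<close>

(* Elements of an L^2 space are represented by functions, not by equivalence classes. *)
definition L2 :: "'a measure \<Rightarrow> ('a \<Rightarrow> real) set" where
  "L2 N = {f \<in> borel_measurable N. integrable N (\<lambda>x. (f x)\<^sup>2)}"

(* The graph of the generator A' of the form E with domain D on L^2(N):
   E(f,h) = (-A' f, h) for all h in D. *)
definition form_generator ::
  "'a measure \<Rightarrow> ('a \<Rightarrow> real) set \<Rightarrow> (('a \<Rightarrow> real) \<Rightarrow> ('a \<Rightarrow> real) \<Rightarrow> real) \<Rightarrow>
   (('a \<Rightarrow> real) \<times> ('a \<Rightarrow> real)) set" where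
  "form_generator N D E =
     {(f, g). f \<in> D \<and> g \<in> L2 N \<and> (\<forall>h\<in>D. E f h = - (\<integral>x. g x * h x \<partial>N))}"

definition generator_kernel ::
  "'a measure \<Rightarrow> ('a \<Rightarrow> real) set \<Rightarrow> (('a \<Rightarrow> real) \<Rightarrow> ('a \<Rightarrow> real) \<Rightarrow> real) \<Rightarrow> ('a \<Rightarrow> real) set" where
  "generator_kernel N D E = {f. (f, \<lambda>_. 0) \<in> form_generator N D E}"

(* p represents the orthogonal projection of f onto K in L^2(N). *)
definition is_orthogonal_projection ::
  "'a measure \<Rightarrow> ('a \<Rightarrow> real) set \<Rightarrow> ('a \<Rightarrow> real) \<Rightarrow> ('a \<Rightarrow> real) \<Rightarrow> bool" where
  "is_orthogonal_projection N K f p \<longleftrightarrow> p \<in> K \<and> (\<forall>k\<in>K. (\<integral>x. (f x - p x) * k x \<partial>N) = 0)"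

definition spectral_gap_at_least ::
  "'a measure \<Rightarrow> ('a \<Rightarrow> real) set \<Rightarrow> (('a \<Rightarrow> real) \<Rightarrow> ('a \<Rightarrow> real) \<Rightarrow> real) \<Rightarrow> real \<Rightarrow> bool" where
  "spectral_gap_at_least N D E \<gamma> \<longleftrightarrow> \<gamma> > 0 \<and>
     (\<forall>f\<in>D. \<exists>p. is_orthogonal_projection N (generator_kernel N D E) f p \<and>
        \<gamma> * (\<integral>x. (f x - p x)\<^sup>2 \<partial>N) \<le> E f f)"

definition is_spectral_gap ::
  "'a measure \<Rightarrow> ('a \<Rightarrow> real) set \<Rightarrow> (('a \<Rightarrow> real) \<Rightarrow> ('a \<Rightarrow> real) \<Rightarrow> real) \<Rightarrow> real \<Rightarrow> bool" where
  "is_spectral_gap N D E \<gamma> \<longleftrightarrow> spectral_gap_at_least N D E \<gamma> \<and>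
     (\<forall>\<gamma>'. spectral_gap_at_least N D E \<gamma>' \<longrightarrow> \<gamma>' \<le> \<gamma>)"

section \<open>The Dirichlet form of the diffusion and the Hardy inequality\<close>

definition has_scale_derivative ::
  "(real \<Rightarrow> real) \<Rightarrow> (real \<Rightarrow> real) \<Rightarrow> (real \<Rightarrow> real) \<Rightarrow> bool" where
  "has_scale_derivative S F f \<longleftrightarrow>
     (\<forall>u v. set_integrable (interval_measure S) {u..v} f) \<and>
     (\<forall>u v. u < v \<longrightarrow> (LINT x:{u..v}|interval_measure S. f x) = F v - F u)"

definition scale_derivative :: "(real \<Rightarrow> real) \<Rightarrow> (real \<Rightarrow> real) \<Rightarrow> real \<Rightarrow> real" where
  "scale_derivative S F = (SOME f. has_scale_derivative S F f)"

definition form_domain :: "(real \<Rightarrow> real) \<Rightarrow> real measure \<Rightarrow> (real \<Rightarrow> real) set" where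
  "form_domain S m = {F \<in> L2 m. (\<exists>f. has_scale_derivative S F f) \<and>
     scale_derivative S F \<in> L2 (interval_measure S)}"

definition dirichlet_form :: "(real \<Rightarrow> real) \<Rightarrow> (real \<Rightarrow> real) \<Rightarrow> (real \<Rightarrow> real) \<Rightarrow> real" where
  "dirichlet_form S F G =
     (\<integral>x. scale_derivative S F x * scale_derivative S G x \<partial>interval_measure S)"

definition killed_domain :: "(real \<Rightarrow> real) \<Rightarrow> real measure \<Rightarrow> real \<Rightarrow> (real \<Rightarrow> real) set" where
  "killed_domain S m a = {f \<in> form_domain S m. \<forall>x\<le>a. f x = 0}"

definition killed_measure :: "real measure \<Rightarrow> real \<Rightarrow> real measure" where
  "killed_measure m a = density m (indicator {a<..})"

(* Both sides are taken in [0,oo], so that A = oo is always admissible (with oo * 0 = 0). *)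
definition hardy_inequality :: "(real \<Rightarrow> real) \<Rightarrow> real measure \<Rightarrow> real \<Rightarrow> ennreal \<Rightarrow> bool" where
  "hardy_inequality S m a A \<longleftrightarrow> (\<forall>F\<in>form_domain S m.
     (\<integral>\<^sup>+x\<in>{a<..}. ennreal ((F x - F a)\<^sup>2) \<partial>m)
     \<le> A * (\<integral>\<^sup>+x\<in>{a<..}. ennreal ((scale_derivative S F x)\<^sup>2) \<partial>interval_measure S))"

definition hardy_constant :: "(real \<Rightarrow> real) \<Rightarrow> real measure \<Rightarrow> real \<Rightarrow> ennreal" where
  "hardy_constant S m a = Inf {A. hardy_inequality S m a A}"

end

(* A function killed below a that is annihilated by the generator has zero derivative and
   vanishes, so the spectral gap condition is just the Poincare inequality on the killed domain.
   That inequality is the Hardy inequality: replacing F by its cut-off, F - F(a) on ]a,oo[ and 0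
   below, changes neither side.  The cut-off lies in L^2(m) because m is finite to the right of a:
   the Green function of ]a-1,b[ at a is bounded below on [a,K] for large b, as S is unbounded,
   whereas the exit time is dominated by the integrable hitting time of a-1.  The gap is attained
   because a ramp function, together with m(]a,oo[) > 0, excludes the Hardy constant 0. *)
theory Submission
  imports Defs
begin

text \<open>Multiplying by \<open>ennreal (1 / \<gamma>)\<close> undoes multiplying by
  \<open>ennreal \<gamma>\<close>, even at infinity. This exchanges a gap \<gamma> for a Hardy
  constant 1 / \<gamma>.\<close>

lemma ennreal_mult_le_iff_le_inverse_mult:
  assumes "\<gamma> > 0"
  shows "ennreal \<gamma> * x \<le> y \<longleftrightarrow> x \<le> ennreal (1 / \<gamma>) * y"
proof -
  have inv: "ennreal (1 / \<gamma>) * (ennreal \<gamma> * z) = z" "ennreal \<gamma> * (ennreal (1 / \<gamma>) * z) = z" for z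
    using assms by (simp_all add: mult.assoc[symmetric] ennreal_mult[symmetric])
  show ?thesis
    using mult_left_mono[of "ennreal \<gamma> * x" y "ennreal (1 / \<gamma>)"]
      mult_left_mono[of x "ennreal (1 / \<gamma>) * y" "ennreal \<gamma>"] by (auto simp: inv)
qed

text \<open>The Green formula with integrand 1: the left side is the mean exit time from
  ]c,b[.\<close>

lemma speed_measure_exit_time:
  assumes "is_speed_measure P X S m" "c < x" "x < b"
  shows "(\<integral>\<^sup>+\<omega>. (\<integral>\<^sup>+t\<in>{t. 0 \<le> t \<and> ennreal t < min (hitting_time X c \<omega>) (hitting_time X b \<omega>)}.
      1 \<partial>lborel) \<partial>P x) = (\<integral>\<^sup>+y\<in>{c<..<b}. ennreal (green S c b x y) \<partial>m)"
  using assms(1)[unfolded is_speed_measure_def, THEN conjunct2, rule_format, of "\<lambda>_. 1" c x b] assms(2,3)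
  by (simp only: mult_1_right borel_measurable_const)

section \<open>Sample paths and hitting times\<close>

context continuous_strong_Markov
begin

lemma prob_space_P: "prob_space (P x)" and sets_P: "sets (P x) = sets M"
  using measurable_space[OF kernel, of x] by (auto simp: space_prob_algebra)

lemma space_P: "space (P x) = space M"
  using sets_eq_imp_space_eq[OF sets_P] .

lemma measurable_X: "0 \<le> t \<Longrightarrow> X t \<in> borel_measurable M"
  using adapted[of t] sets_F_subset[of "ennreal t"] space_F[of "ennreal t"]
  by (auto simp: measurable_def)

text \<open>A continuous path is bounded on a compact time interval, so before a finite time it
  visits only finitely many integer levels.\<close>

lemma hitting_time_infinite_if_frequently_after:
  assumes "\<omega> \<in> space M" "\<exists>\<^sub>F n in sequentially. hitting_time X (real n) \<omega> < hitting_time X c \<omega>"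
  shows "hitting_time X c \<omega> = \<infinity>"
proof (rule ccontr)
  assume "hitting_time X c \<omega> \<noteq> \<infinity>"
  then obtain r where r: "0 \<le> r" "hitting_time X c \<omega> = ennreal r"
    by (cases "hitting_time X c \<omega>") auto
  have "compact ((\<lambda>t. X t \<omega>) ` {0..r})"
    by (intro compact_continuous_image continuous_on_subset[OF continuous_paths[OF assms(1)]]) auto
  then obtain K where K: "\<And>t. t \<in> {0..r} \<Longrightarrow> \<bar>X t \<omega>\<bar> \<le> K"
    by (meson bounded_real compact_imp_bounded imageI)
  obtain n where n: "n \<ge> nat \<lceil>K + 1\<rceil>" "hitting_time X (real n) \<omega> < hitting_time X c \<omega>"
    using assms(2) unfolding frequently_sequentially by blast
  have nK: "real n > K" using n(1) by linarith
  from n(2) obtain t where "0 \<le> t" "X t \<omega> = real n" "ennreal t < ennreal r"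
    unfolding r(2) by (auto simp: hitting_time_def INF_less_iff)
  with K[of t] nK r(1) show False
    by (auto simp: ennreal_less_iff)
qed

end

section \<open>Scale function and speed measure under positive recurrence\<close>

context positively_recurrent_diffusion
begin

text \<open>If S stayed below K, then from x each level n > x would be reached before x - 1 with
  probability at least a fixed \<delta> > 0. With probability at least \<delta> this would happen
  for infinitely many n, making the hitting time of x - 1 infinite, against its finite mean.\<close>

lemma scale_function_unbounded:
  assumes "is_scale_function P X S"
  shows "\<exists>b>x. S b > K"
proof (rule ccontr)
  assume "\<not> ?thesis"
  then have bd: "S b \<le> K" if "b > x" for b using that by force
  interpret prob_space "P x" by (rule prob_space_P)
  define c where "c = x - 1"
  have S: "strict_mono S" using assms by (simp add: is_scale_function_def)
  define B where "B n = {\<omega>\<in>space (P x). hitting_time X (real n) \<omega> < hitting_time X c \<omega>}" for n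
  \<comment> \<open>In the scale formula for reaching n before c, replacing S n by its bound K gives
    a lower bound free of n.\<close>
  define \<delta> where "\<delta> = (S x - S c) / (K - S c)"
  have less: "S c < S x" using S by (simp add: c_def strict_mono_less)
  have "S x < S (x + 1)" using S by (simp add: strict_mono_less)
  with bd[of "x+1"] have K: "S x < K" by simp
  have \<delta>: "\<delta> > 0" using less K by (simp add: \<delta>_def)
  have pB: "prob (B n) \<ge> \<delta>" if "real n > x" for n
  proof -
    have "prob (B n) = (S x - S c) / (S n - S c)"
      using assms that unfolding B_def is_scale_function_def by (auto simp: c_def)
    moreover have "S x < S n" using S that by (simp add: strict_mono_less)
    ultimately show ?thesis
      using less bd[OF that] unfolding \<delta>_def by (auto intro!: divide_left_mono mult_pos_pos)
  qed
  \<comment> \<open>Hitting times are not known to be measurable, but \<^const>\<open>measure\<close> is 0 off the measurable sets.\<close>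
  have meas: "B n \<in> events" if "real n > x" for n
    using pB[OF that] \<delta> measure_notin_sets by fastforce
  obtain N0 :: nat where N0: "real N0 > x" using reals_Archimedean2 by blast
  \<comment> \<open>These tails decrease to the event that infinitely many \<open>B n\<close> occur.
    The shift by \<open>N0\<close> keeps the indices beyond x, where \<open>B n\<close> is
    measurable.\<close>
  define C where "C N = (\<Union>n\<in>{N+N0..}. B n)" for N
  have C: "C N \<in> events" for N
    unfolding C_def using meas N0 by (intro sets.countable_UN') auto
  have lim: "(\<lambda>N. prob (C N)) \<longlonglongrightarrow> prob (\<Inter>N. C N)"
    using C by (intro finite_Lim_measure_decseq) (fastforce simp: decseq_def C_def)+
  have "prob (C N) \<ge> \<delta>" for N
  proof -
    have "prob (B (N+N0)) \<le> prob (C N)"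
      using C by (intro finite_measure_mono) (auto simp: C_def)
    with pB[of "N+N0"] N0 show ?thesis by simp
  qed
  with lim have ge: "prob (\<Inter>N. C N) \<ge> \<delta>"
    by (meson Lim_bounded2)
  have inf: "hitting_time X c \<omega> = \<infinity>" if "\<omega> \<in> (\<Inter>N. C N)" for \<omega>
  proof (rule hitting_time_infinite_if_frequently_after)
    show "\<omega> \<in> space M" using that by (auto simp: C_def B_def space_P)
    show "\<exists>\<^sub>F n in sequentially. hitting_time X (real n) \<omega> < hitting_time X c \<omega>"
      unfolding frequently_sequentially
    proof
      fix N
      from that obtain n where "n \<ge> N + N0" "\<omega> \<in> B n" by (auto simp: C_def)
      then show "\<exists>n\<ge>N. hitting_time X (real n) \<omega> < hitting_time X c \<omega>"
        by (auto simp: B_def intro!: exI[of _ n])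
    qed
  qed
  \<comment> \<open>The hitting time is infinite on the limiting event, so its finite mean leaves
    that event no mass.\<close>
  have "\<infinity> * emeasure (P x) (\<Inter>N. C N) = (\<integral>\<^sup>+\<omega>. \<infinity> * indicator (\<Inter>N. C N) \<omega> \<partial>P x)"
    using C by (subst nn_integral_cmult_indicator) auto
  also have "\<dots> \<le> (\<integral>\<^sup>+\<omega>. hitting_time X c \<omega> \<partial>P x)"
    by (intro nn_integral_mono) (auto simp: inf indicator_def)
  also have "\<dots> < \<infinity>" by (rule positively_recurrent)
  finally have "emeasure (P x) (\<Inter>N. C N) = 0"
    by (auto simp: ennreal_mult_eq_top_iff ennreal_top_mult split: if_splits)
  then have "prob (\<Inter>N. C N) = 0" by (simp add: measure_def)
  with ge \<delta> show False by simp
qed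

lemma speed_measure_finite_right:
  assumes S: "is_scale_function P X S" and m: "is_speed_measure P X S m"
  shows "emeasure m {a..} < \<infinity>"
proof -
  define c where "c = a - 1"
  define C where "C = (\<integral>\<^sup>+\<omega>. hitting_time X c \<omega> \<partial>P a)"
  \<comment> \<open>As b grows, the Green function at y \<ge> a tends to S a - S c. Half of this is
    a lower bound from some b on, uniformly for y in a bounded interval.\<close>
  define \<delta> where "\<delta> = (S a - S c) / 2"
  have mono: "S u < S v \<longleftrightarrow> u < v" "S u \<le> S v \<longleftrightarrow> u \<le> v" for u v
    using S by (auto simp: is_scale_function_def strict_mono_less strict_mono_less_eq)
  have \<delta>: "\<delta> > 0" using mono(1)[of c a] by (simp add: \<delta>_def c_def)
  have sets_m: "sets m = sets borel" using m by (simp add: is_speed_measure_def)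
  have bound: "ennreal \<delta> * emeasure m {a..K} \<le> C" if "K > a" for K
  proof -
    \<comment> \<open>The second condition rearranges to S b - S K > (S b - S c) / 2.\<close>
    obtain b where b: "b > K" "S b > 2 * S K - S c"
      using scale_function_unbounded[OF S, of K] by blast
    have Sb: "S b > S c" "S a > S c" using mono(1) b(1) that by (auto simp: c_def)
    have green: "green S c b a y \<ge> \<delta>" if y: "y \<in> {a..K}" for y
    proof -
      have "S y \<le> S K" using y mono(2) by auto
      then have "(S b - S c) / 2 * (S a - S c) \<le> (S b - S y) * (S a - S c)"
        using b(2) Sb by (intro mult_right_mono) auto
      then have "\<delta> \<le> (S b - S y) * (S a - S c) / (S b - S c)"
        using Sb(1) by (subst pos_le_divide_eq) (auto simp: \<delta>_def mult.commute)
      also have "\<dots> = green S c b a y"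
        using y by (simp add: green_def max_def min_def)
      finally show ?thesis .
    qed
    have "ennreal \<delta> * emeasure m {a..K} = (\<integral>\<^sup>+y. ennreal \<delta> * indicator {a..K} y \<partial>m)"
      using sets_m by (subst nn_integral_cmult_indicator) auto
    also have "\<dots> \<le> (\<integral>\<^sup>+y\<in>{c<..<b}. ennreal (green S c b a y) * 1 \<partial>m)"
      using b(1) green by (intro nn_integral_mono) (auto simp: indicator_def c_def intro!: ennreal_leI)
    also have "\<dots> = (\<integral>\<^sup>+\<omega>. (\<integral>\<^sup>+t\<in>{t. 0 \<le> t \<and> ennreal t < min (hitting_time X c \<omega>) (hitting_time X b \<omega>)}.
            1 \<partial>lborel) \<partial>P a)"
      using speed_measure_exit_time[OF m, of c a b] b(1) that by (simp add: c_def)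
    also have "\<dots> \<le> C"
      unfolding C_def
    proof (intro nn_integral_mono)
      fix \<omega>
      show "(\<integral>\<^sup>+t\<in>{t. 0 \<le> t \<and> ennreal t < min (hitting_time X c \<omega>) (hitting_time X b \<omega>)}.
            1 \<partial>lborel) \<le> hitting_time X c \<omega>"
      proof (cases "hitting_time X c \<omega>")
        case (real r)
        have "(\<integral>\<^sup>+t\<in>{t. 0 \<le> t \<and> ennreal t < min (hitting_time X c \<omega>) (hitting_time X b \<omega>)}.
            1 \<partial>lborel) \<le> (\<integral>\<^sup>+t. indicator {0..<r} t \<partial>lborel)"
          using real by (intro nn_integral_mono) (auto simp: indicator_def ennreal_less_iff)
        with real show ?thesis by simp
      qed simp
    qed
    finally show ?thesis .
  qed
  \<comment> \<open>The endpoints use \<open>Suc n\<close> because \<open>bound\<close> asks for K >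
    a strictly.\<close>
  have "(\<Union>n. {a..a + real (Suc n)}) = {a..}"
  proof (intro equalityI subsetI)
    fix y assume "y \<in> {a..}"
    moreover obtain n where "y - a < real n" using reals_Archimedean2 by blast
    ultimately show "y \<in> (\<Union>n. {a..a + real (Suc n)})" by (auto intro!: exI[of _ n])
  qed auto
  then have "emeasure m {a..} = (SUP n. emeasure m {a..a + real (Suc n)})"
    using sets_m by (subst SUP_emeasure_incseq) (auto simp: incseq_def)
  also have "\<dots> \<le> ennreal (1 / \<delta>) * C"
    using bound \<delta> by (intro SUP_least) (simp flip: ennreal_mult_le_iff_le_inverse_mult)
  also have "\<dots> < \<infinity>"
    using positively_recurrent[of a c] by (simp add: C_def ennreal_mult_less_top)
  finally show ?thesis .
qed

text \<open>Were the interval null for m, the mean exit time from its midpoint would be zero,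
  whereas a continuous path needs a positive time to leave.\<close>

lemma speed_measure_charges_interval:
  assumes m: "is_speed_measure P X S m" and "u < v"
  shows "emeasure m {u<..<v} > 0"
proof (rule ccontr)
  assume "\<not> ?thesis"
  then have null: "emeasure m {u<..<v} = 0" by simp
  have sets_m: "sets m = sets borel" using m by (simp add: is_speed_measure_def)
  define x where "x = (u + v) / 2"
  \<comment> \<open>[c',b'] is a neighbourhood of x that excludes u and v and, being closed, keeps
    limits of path values.\<close>
  define c' where "c' = (u + x) / 2"
  define b' where "b' = (x + v) / 2"
  have ord: "u < c'" "c' < x" "x < b'" "b' < v"
    using \<open>u < v\<close> by (auto simp: x_def c'_def b'_def)
  interpret prob_space "P x" by (rule prob_space_P)
  let ?\<tau> = "\<lambda>\<omega>. \<integral>\<^sup>+t\<in>{t. 0 \<le> t \<and> ennreal t < min (hitting_time X u \<omega>) (hitting_time X v \<omega>)}. 1 \<partial>lborel"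
  have "(\<integral>\<^sup>+\<omega>. ?\<tau> \<omega> \<partial>P x) = (\<integral>\<^sup>+y\<in>{u<..<v}. ennreal (green S u v x y) * 1 \<partial>m)"
    using speed_measure_exit_time[OF m, of u x v] ord by simp
  also have "\<dots> = (\<integral>\<^sup>+y. 0 \<partial>m)"
  proof (intro nn_integral_cong_AE)
    have "AE y in m. y \<notin> {u<..<v}"
      using null sets_m by (intro AE_not_in) (auto simp: null_sets_def)
    then show "AE y in m. ennreal (green S u v x y) * 1 * indicator {u<..<v} y = 0"
      by eventually_elim auto
  qed
  finally have zero: "(\<integral>\<^sup>+\<omega>. ?\<tau> \<omega> \<partial>P x) = 0" by simp
  \<comment> \<open>The exit time need not be measurable, so a positive lower integral requires measurable
    sets on which it is bounded below.\<close>
  define B where "B n = {\<omega>\<in>space M. \<forall>q\<in>\<rat> \<inter> {0..1 / real (Suc n)}. X q \<omega> \<in> {c'..b'}}" for n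
  have B: "B n \<in> events" for n
  proof -
    have "B n = (\<Inter>q\<in>\<rat> \<inter> {0..1 / real (Suc n)}. X q -` {c'..b'} \<inter> space M)"
      by (auto simp: B_def intro: exI[of _ 0])
    also have "\<dots> \<in> sets M"
      using measurable_X
      by (intro sets.countable_INT' measurable_sets[where A = borel]) (auto intro!: countable_Int1 countable_rat exI[of _ 0])
    finally show ?thesis by (simp add: sets_P)
  qed
  \<comment> \<open>Rational times are dense, so path continuity carries the constraint to all times
    of the interval, endpoints included.\<close>
  have inB: "X t \<omega> \<in> {c'..b'}" if "\<omega> \<in> B n" "t \<in> {0..1 / real (Suc n)}" for \<omega> n t
  proof -
    have "\<omega> \<in> space M" using that(1) by (simp add: B_def)
    let ?I = "{0<..<1 / real (Suc n)} \<inter> \<rat>"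
    have closure: "closure ?I = {0..1 / real (Suc n)}"
      by (subst closure_open_Int_superset) (auto simp: Rats_closure_real)
    have "(\<lambda>t. X t \<omega>) ` closure ?I \<subseteq> {c'..b'}"
    proof (rule image_closure_subset)
      show "continuous_on (closure ?I) (\<lambda>t. X t \<omega>)"
        unfolding closure by (rule continuous_on_subset[OF continuous_paths[OF \<open>\<omega> \<in> space M\<close>]]) auto
      show "(\<lambda>t. X t \<omega>) ` ?I \<subseteq> {c'..b'}"
        using that(1) by (fastforce simp: B_def)
    qed simp
    then show ?thesis using that(2) unfolding closure by blast
  qed
  have null_B: "B n \<in> null_sets (P x)" for n
  proof -
    have hit: "ennreal (1 / real (Suc n)) \<le> hitting_time X w \<omega>"
      if "\<omega> \<in> B n" "w \<notin> {c'..b'}" for \<omega> w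
      unfolding hitting_time_def
    proof (intro INF_greatest, rule ccontr)
      fix t assume "t \<in> {t. 0 \<le> t \<and> X t \<omega> = w}" "\<not> ennreal (1 / real (Suc n)) \<le> ennreal t"
      with inB[OF that(1), of t] that(2) show False
        by (auto simp: not_le ennreal_less_iff)
    qed
    \<comment> \<open>A Chebyshev bound: the exit time is at least 1 / (n + 1) on \<open>B n\<close>
      and has mean zero.\<close>
    have "ennreal (1 / real (Suc n)) * emeasure (P x) (B n)
        = (\<integral>\<^sup>+\<omega>. ennreal (1 / real (Suc n)) * indicator (B n) \<omega> \<partial>P x)"
      using B by (subst nn_integral_cmult_indicator) auto
    also have "\<dots> \<le> (\<integral>\<^sup>+\<omega>. ?\<tau> \<omega> \<partial>P x)"
    proof (intro nn_integral_mono)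
      fix \<omega>
      show "ennreal (1 / real (Suc n)) * indicator (B n) \<omega> \<le> ?\<tau> \<omega>"
      proof (cases "\<omega> \<in> B n")
        case True
        have "ennreal (1 / real (Suc n)) = (\<integral>\<^sup>+t. indicator {0..<1 / real (Suc n)} t \<partial>lborel)"
          by simp
        also have "\<dots> \<le> ?\<tau> \<omega>"
        proof (intro nn_integral_mono)
          fix t
          have "ennreal t < min (hitting_time X u \<omega>) (hitting_time X v \<omega>)"
            if "t \<in> {0..<1 / real (Suc n)}"
          proof -
            have "ennreal t < ennreal (1 / real (Suc n))" using that by (simp add: ennreal_less_iff)
            with hit[OF True, of u] hit[OF True, of v] ord show ?thesis by auto
          qed
          then show "(indicator {0..<1 / real (Suc n)} t :: ennreal)
              \<le> 1 * indicator {t. 0 \<le> t \<and> ennreal t < min (hitting_time X u \<omega>) (hitting_time X v \<omega>)} t"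
            by (auto simp: indicator_def)
        qed
        finally show ?thesis using True by simp
      qed simp
    qed
    finally have "ennreal (1 / real (Suc n)) * emeasure (P x) (B n) = 0" using zero by simp
    then show ?thesis using B by (auto simp: null_sets_def ennreal_eq_0_iff)
  qed
  \<comment> \<open>By continuity at time 0, almost every path belongs to some \<open>B n\<close>,
    yet the union of these events is null.\<close>
  have "AE \<omega> in P x. \<omega> \<notin> (\<Union>n. B n)"
    using null_B by (intro AE_not_in null_sets_UN) auto
  moreover have "AE \<omega> in P x. X 0 \<omega> = x" by (rule start)
  moreover have "AE \<omega> in P x. \<omega> \<in> space M" using AE_space[of "P x"] by (simp add: space_P)
  ultimately have "AE \<omega> in P x. False"
  proof eventually_elim
    fix \<omega> assume \<omega>: "\<omega> \<notin> (\<Union>n. B n)" "X 0 \<omega> = x" "\<omega> \<in> space M"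
    have "continuous (at 0 within {0..}) (\<lambda>t. X t \<omega>)"
      using continuous_paths[OF \<omega>(3)] by (simp add: continuous_on_eq_continuous_within)
    then have "((\<lambda>t. X t \<omega>) \<longlongrightarrow> x) (at 0 within {0..})"
      using \<omega>(2) by (simp add: continuous_within)
    then have "\<forall>\<^sub>F t in at 0 within {0..}. X t \<omega> \<in> {c'<..<b'}"
      using ord by (intro topological_tendstoD) auto
    then obtain d where d: "d > 0" "\<And>t. t > 0 \<Longrightarrow> t < d \<Longrightarrow> X t \<omega> \<in> {c'<..<b'}"
      unfolding eventually_at by (auto simp: dist_real_def)
    obtain n where n: "1 / real (Suc n) < d"
      using reals_Archimedean[OF d(1)] by (auto simp: inverse_eq_divide)
    have "X t \<omega> \<in> {c'..b'}" if "t \<in> {0..1 / real (Suc n)}" for t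
      using d(2)[of t] that n \<omega>(2) ord by (cases "t = 0") auto
    then have "\<omega> \<in> B n" using \<omega>(3) by (auto simp: B_def)
    with \<omega>(1) show False by auto
  qed
  then show False by simp
qed

end

section \<open>Calculus of scale derivatives\<close>

locale scale =
  fixes S :: "real \<Rightarrow> real"
  assumes strict_mono_S: "strict_mono S" and continuous_S: "continuous_on UNIV S"
begin

lemma emeasure_Icc: "u \<le> v \<Longrightarrow> emeasure (interval_measure S) {u..v} = ennreal (S v - S u)"
  using strict_mono_S continuous_S
  by (intro emeasure_interval_measure_Icc) (auto simp: strict_mono_less_eq)

lemma emeasure_singleton: "emeasure (interval_measure S) {x} = 0"
  using emeasure_Icc[of x x] by simp

text \<open>Continuity of S leaves dS without atoms; this makes open and closed ends of intervals
  interchangeable below.\<close>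

lemma AE_neq: "AE x in interval_measure S. x \<noteq> c"
  using emeasure_singleton[of c] AE_not_in[of "{c}" "interval_measure S"] by (auto simp: null_sets_def)

text \<open>Sigma-finiteness makes densities with respect to dS unique almost everywhere, on which
  the uniqueness of scale derivatives rests.\<close>

sublocale sigma_finite_measure "interval_measure S"
  using strict_mono_S continuous_S
  by (intro sigma_finite_interval_measure)
    (auto simp: strict_mono_less_eq continuous_on_eq_continuous_within intro: continuous_within_subset)

text \<open>Integrability is known on compact intervals only, so f is recovered as the pointwise
  limit of its restrictions to them.\<close>

lemma has_scale_derivative_measurable:
  assumes "has_scale_derivative S F f"
  shows "f \<in> borel_measurable borel"
proof (rule borel_measurable_LIMSEQ_real)
  show "(\<lambda>x. indicator {- real n..real n} x * f x) \<in> borel_measurable borel" for n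
    using assms borel_measurable_integrable[of "interval_measure S"]
    by (auto simp: has_scale_derivative_def set_integrable_def cong: measurable_cong_sets)
  show "(\<lambda>n. indicator {- real n..real n} x * f x) \<longlonglongrightarrow> f x" for x
  proof (rule tendsto_eventually)
    obtain N :: nat where N: "\<bar>x\<bar> \<le> real N" using real_arch_simple by blast
    show "\<forall>\<^sub>F n in sequentially. indicator {- real n..real n} x * f x = f x"
      using N by (intro eventually_sequentiallyI[of N]) (auto simp: indicator_def)
  qed
qed

text \<open>On each window [-n,n] the positive and negative parts of d give every right half-line
  the same finite mass. They are thus densities of one measure and agree almost everywhere, so both
  vanish there.\<close>

lemma AE_zero_if_integral_Icc_zero:
  fixes d :: "real \<Rightarrow> real"
  assumes int: "\<And>u v. set_integrable (interval_measure S) {u..v} d"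
    and zero: "\<And>u v. u < v \<Longrightarrow> (LINT x:{u..v}|interval_measure S. d x) = 0"
  shows "AE x in interval_measure S. d x = 0"
proof -
  let ?\<mu> = "interval_measure S"
  have "AE x in ?\<mu>. indicator {- real n..real n} x * d x = 0" for n
  proof -
    define g where "g x = indicator {- real n..real n} x * d x" for x
    have g: "integrable ?\<mu> g"
      using int[of "- real n" "real n"] by (simp add: g_def[abs_def] set_integrable_def)
    note [measurable] = borel_measurable_integrable[OF g]
    have tail: "(\<integral>\<^sup>+x\<in>{u<..}. ennreal (g x) \<partial>?\<mu>) = (\<integral>\<^sup>+x\<in>{u<..}. ennreal (- g x) \<partial>?\<mu>)"
      and fin: "(\<integral>\<^sup>+x\<in>{u<..}. ennreal (g x) \<partial>?\<mu>) < \<infinity>" for u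
    proof -
      define h where "h x = indicator {u<..} x * g x" for x
      have h: "integrable ?\<mu> h"
        unfolding h_def using integrable_mult_indicator[OF _ g, of "{u<..}"] by simp
      \<comment> \<open>Apart from the massless point u, h is d cut to a closed interval, where
        \<open>zero\<close> applies unless the interval degenerates.\<close>
      have "integral\<^sup>L ?\<mu> h = integral\<^sup>L ?\<mu> (\<lambda>x. indicator {max u (- real n)..real n} x * d x)"
        using AE_neq[of u] borel_measurable_integrable[OF h]
          borel_measurable_integrable[OF int[of "max u (- real n)" "real n", unfolded set_integrable_def]]
        by (intro integral_cong_AE) (auto simp: h_def g_def indicator_def elim!: eventually_mono)
      also have "\<dots> = 0"
      proof (cases "max u (- real n) < real n")
        case True
        then show ?thesis using zero[OF True] by (simp add: set_lebesgue_integral_def)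
      next
        case False
        then have "{max u (- real n)..real n} \<subseteq> {real n}" by auto
        then have "AE x in ?\<mu>. indicator {max u (- real n)..real n} x * d x = 0"
          using AE_neq[of "real n"] by (auto elim!: eventually_mono simp: indicator_def)
        then show ?thesis by (rule integral_eq_zero_AE)
      qed
      \<comment> \<open>\<open>ennreal\<close> sends negative reals to 0, so these are the integrals
        of the positive and negative parts of h.\<close>
      finally have "enn2real (\<integral>\<^sup>+x. ennreal (h x) \<partial>?\<mu>) = enn2real (\<integral>\<^sup>+x. ennreal (- h x) \<partial>?\<mu>)"
        using real_lebesgue_integral_def[OF h] by simp
      moreover have fin': "(\<integral>\<^sup>+x. ennreal (h x) \<partial>?\<mu>) < \<infinity>" "(\<integral>\<^sup>+x. ennreal (- h x) \<partial>?\<mu>) < \<infinity>"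
        using h by (auto simp: real_integrable_def less_top)
      ultimately have "(\<integral>\<^sup>+x. ennreal (h x) \<partial>?\<mu>) = (\<integral>\<^sup>+x. ennreal (- h x) \<partial>?\<mu>)"
        by (metis ennreal_enn2real infinity_ennreal_def)
      moreover have "(\<integral>\<^sup>+x. ennreal (h x) \<partial>?\<mu>) = (\<integral>\<^sup>+x\<in>{u<..}. ennreal (g x) \<partial>?\<mu>)"
        and "(\<integral>\<^sup>+x. ennreal (- h x) \<partial>?\<mu>) = (\<integral>\<^sup>+x\<in>{u<..}. ennreal (- g x) \<partial>?\<mu>)"
        by (auto intro!: nn_integral_cong simp: h_def indicator_def)
      ultimately show "(\<integral>\<^sup>+x\<in>{u<..}. ennreal (g x) \<partial>?\<mu>) = (\<integral>\<^sup>+x\<in>{u<..}. ennreal (- g x) \<partial>?\<mu>)"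
        and "(\<integral>\<^sup>+x\<in>{u<..}. ennreal (g x) \<partial>?\<mu>) < \<infinity>"
        using fin' by simp_all
    qed
    \<comment> \<open>The half-lines ]u,oo[ generate the Borel sets and are stable under
      intersection, so agreement with finite values on them suffices.\<close>
    have "density ?\<mu> (\<lambda>x. ennreal (g x)) = density ?\<mu> (\<lambda>x. ennreal (- g x))"
      using tail fin by (intro measure_eqI_lessThan) (auto simp: emeasure_density)
    then have "AE x in ?\<mu>. ennreal (g x) = ennreal (- g x)"
      by (intro density_unique) auto
    then show ?thesis
      unfolding g_def[symmetric]
    proof eventually_elim
      fix x assume "ennreal (g x) = ennreal (- g x)"
      then show "g x = 0" by (cases "g x \<ge> 0") (auto simp: ennreal_neg ennreal_eq_0_iff)
    qed
  qed
  then have "AE x in ?\<mu>. \<forall>n. indicator {- real n..real n} x * d x = 0"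
    by (subst AE_all_countable) simp
  then show ?thesis
  proof eventually_elim
    fix x assume eq: "\<forall>n. indicator {- real n..real n} x * d x = 0"
    obtain N :: nat where "\<bar>x\<bar> \<le> real N" using real_arch_simple by blast
    with eq[rule_format, of N] show "d x = 0" by (auto simp: indicator_def)
  qed
qed

lemma has_scale_derivative_unique:
  assumes "has_scale_derivative S F f" "has_scale_derivative S F g"
  shows "AE x in interval_measure S. f x = g x"
proof -
  have "AE x in interval_measure S. f x - g x = 0"
    using assms
    by (intro AE_zero_if_integral_Icc_zero) (auto simp: has_scale_derivative_def set_integral_diff)
  then show ?thesis by simp
qed

lemma has_scale_derivative_scale_derivative:
  "has_scale_derivative S F f \<Longrightarrow> has_scale_derivative S F (scale_derivative S F)"
  unfolding scale_derivative_def by (rule someI[where P = "has_scale_derivative S F"])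

text \<open>\<open>scale_derivative\<close> picks an arbitrary version; this lets any explicit
  derivative stand in for it under an integral.\<close>

lemma scale_derivative_eq_AE:
  "has_scale_derivative S F f \<Longrightarrow> AE x in interval_measure S. scale_derivative S F x = f x"
  using has_scale_derivative_unique has_scale_derivative_scale_derivative by blast

lemma form_domainI:
  assumes "has_scale_derivative S F f" "F \<in> L2 m" "integrable (interval_measure S) (\<lambda>x. (f x)\<^sup>2)"
  shows "F \<in> form_domain S m"
proof -
  have [measurable]: "scale_derivative S F \<in> borel_measurable borel" "f \<in> borel_measurable borel"
    using assms(1) has_scale_derivative_scale_derivative has_scale_derivative_measurable by blast+
  have "integrable (interval_measure S) (\<lambda>x. (scale_derivative S F x)\<^sup>2)"
    using scale_derivative_eq_AE[OF assms(1)]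
    by (subst integrable_cong_AE[where g = "\<lambda>x. (f x)\<^sup>2"]) (auto elim!: eventually_mono intro: assms(3))
  then show ?thesis using assms by (auto simp: form_domain_def L2_def cong: measurable_cong_sets)
qed

lemma integral_Icc:
  assumes "has_scale_derivative S F f" "u \<le> v"
  shows "(LINT x:{u..v}|interval_measure S. f x) = F v - F u"
proof (cases "u = v")
  case True
  have "AE x in interval_measure S. indicator {v..v} x *\<^sub>R f x = 0"
    using AE_neq[of v] by eventually_elim (simp add: indicator_def)
  then show ?thesis
    unfolding True set_lebesgue_integral_def by (subst integral_eq_zero_AE) auto
qed (use assms in \<open>auto simp: has_scale_derivative_def\<close>)

text \<open>Integrating the truncated derivative over {u..v} is integrating f over {max a u..v},
  which gives the increment of the cut function.\<close>

lemma has_scale_derivative_cut_below: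
  assumes "has_scale_derivative S F f"
  shows "has_scale_derivative S (\<lambda>x. F (max a x) - F a) (\<lambda>x. indicator {a..} x * f x)"
  unfolding has_scale_derivative_def
proof (intro conjI allI impI)
  have ind: "indicator {u..v} x *\<^sub>R (indicator {a..} x * f x) = indicator {max a u..v} x *\<^sub>R f x" for u v x :: real
    by (auto simp: indicator_def)
  show "set_integrable (interval_measure S) {u..v} (\<lambda>x. indicator {a..} x * f x)" for u v
    using assms by (simp only: set_integrable_def has_scale_derivative_def ind)
  fix u v :: real assume "u < v"
  have "(LINT x:{u..v}|interval_measure S. indicator {a..} x * f x) = (LINT x:{max a u..v}|interval_measure S. f x)"
    by (simp only: set_lebesgue_integral_def ind)
  \<comment> \<open>For v < a the range of integration is empty and the cut function is 0 at both
    ends.\<close>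
  then show "(LINT x:{u..v}|interval_measure S. indicator {a..} x * f x) = F (max a v) - F a - (F (max a u) - F a)"
    using integral_Icc[OF assms, of "max a u" v] \<open>u < v\<close>
    by (cases "a \<le> v") (simp_all add: set_lebesgue_integral_def[of _ "{}"])
qed

text \<open>The mirror image of the cut from below; it serves to flatten S into a ramp.\<close>

lemma has_scale_derivative_cut_above:
  assumes "has_scale_derivative S F f"
  shows "has_scale_derivative S (\<lambda>x. F (min b x)) (\<lambda>x. indicator {..b} x * f x)"
  unfolding has_scale_derivative_def
proof (intro conjI allI impI)
  have ind: "indicator {u..v} x *\<^sub>R (indicator {..b} x * f x) = indicator {u..min b v} x *\<^sub>R f x" for u v x :: real
    by (auto simp: indicator_def)
  show "set_integrable (interval_measure S) {u..v} (\<lambda>x. indicator {..b} x * f x)" for u v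
    using assms by (simp only: set_integrable_def has_scale_derivative_def ind)
  fix u v :: real assume "u < v"
  have "(LINT x:{u..v}|interval_measure S. indicator {..b} x * f x) = (LINT x:{u..min b v}|interval_measure S. f x)"
    by (simp only: set_lebesgue_integral_def ind)
  then show "(LINT x:{u..v}|interval_measure S. indicator {..b} x * f x) = F (min b v) - F (min b u)"
    using integral_Icc[OF assms, of u "min b v"] \<open>u < v\<close>
    by (cases "u \<le> b") (simp_all add: set_lebesgue_integral_def[of _ "{}"])
qed

lemma has_scale_derivative_self: "has_scale_derivative S S (\<lambda>_. 1)"
proof -
  have "emeasure (interval_measure S) {u..v} < \<infinity>" for u v
    using emeasure_Icc[of u v] by (cases "u \<le> v") auto
  then have "set_integrable (interval_measure S) {u..v} (\<lambda>_. 1 :: real)" for u v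
    by (simp add: set_integrable_def)
  moreover have "measure (interval_measure S) {u..v} = S v - S u" if "u < v" for u v
    using emeasure_Icc[of u v] that strict_mono_S by (simp add: measure_def strict_mono_less_eq)
  ultimately show ?thesis
    by (auto simp: has_scale_derivative_def set_lebesgue_integral_def)
qed

lemma has_scale_derivative_zero: "has_scale_derivative S (\<lambda>_. 0) (\<lambda>_. 0)"
  by (simp add: has_scale_derivative_def set_integrable_def set_lebesgue_integral_def)

end

section \<open>The killed form, its Hardy inequality and its spectral gap\<close>

locale scale_speed = scale S for S +
  fixes m :: "real measure" and a :: real
  assumes sets_m [simp, measurable_cong]: "sets m = sets borel"
    and finite_right: "emeasure m {a..} < \<infinity>"
    and charges_right: "emeasure m {a<..} > 0"
begin

lemma form_domainD:
  assumes "F \<in> form_domain S m"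
  shows "has_scale_derivative S F (scale_derivative S F)"
    and "F \<in> borel_measurable borel" "integrable m (\<lambda>x. (F x)\<^sup>2)"
    and "scale_derivative S F \<in> borel_measurable borel"
    and "integrable (interval_measure S) (\<lambda>x. (scale_derivative S F x)\<^sup>2)"
  using assms has_scale_derivative_scale_derivative
  by (auto simp: form_domain_def L2_def cong: measurable_cong_sets)

lemma cut_in_killed_domain:
  assumes F: "F \<in> form_domain S m"
  shows "(\<lambda>x. F (max a x) - F a) \<in> killed_domain S m a"
proof -
  note D = form_domainD[OF F]
  note [measurable] = D(2,4)
  let ?G = "\<lambda>x. F (max a x) - F a"
  have [measurable]: "?G \<in> borel_measurable borel" by measurable
  have "?G \<in> L2 m"
    unfolding L2_def
  proof (intro CollectI conjI)
    show "?G \<in> borel_measurable m" by measurable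
    \<comment> \<open>This dominates the square of the cut; its constant term is integrable because
      m is finite on {a..}.\<close>
    have "integrable m (\<lambda>x. 2 * (F x)\<^sup>2 + indicator {a..} x * (2 * (F a)\<^sup>2))"
      using D(3) finite_right by (intro Bochner_Integration.integrable_add integrable_mult_right integrable_mult_left) auto
    then show "integrable m (\<lambda>x. (?G x)\<^sup>2)"
    proof (rule Bochner_Integration.integrable_bound)
      have "(F x - F a)\<^sup>2 \<le> 2 * (F x)\<^sup>2 + 2 * (F a)\<^sup>2" for x
        using zero_le_power2[of "F x + F a"] by (simp add: power2_sum power2_diff)
      then show "AE x in m. norm ((?G x)\<^sup>2) \<le> norm (2 * (F x)\<^sup>2 + indicator {a..} x * (2 * (F a)\<^sup>2))"
        by (intro AE_I2) (auto simp: indicator_def max_def)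
    qed measurable
  qed
  moreover have "integrable (interval_measure S) (\<lambda>x. (indicator {a..} x * scale_derivative S F x)\<^sup>2)"
    using D(5) by (rule Bochner_Integration.integrable_bound) (auto simp: indicator_def)
  ultimately have "?G \<in> form_domain S m"
    using has_scale_derivative_cut_below[OF D(1), of a] by (intro form_domainI)
  then show ?thesis by (simp add: killed_domain_def max_def)
qed

text \<open>Passing from {a..} to {a<..}, the range in the Hardy inequality, costs nothing as dS has
  no atoms.\<close>

lemma scale_derivative_cut_AE:
  assumes "F \<in> form_domain S m"
  shows "AE x in interval_measure S.
    scale_derivative S (\<lambda>x. F (max a x) - F a) x = indicator {a<..} x * scale_derivative S F x"
  using scale_derivative_eq_AE[OF has_scale_derivative_cut_below[OF form_domainD(1)[OF assms], of a]] AE_neq[of a]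
  by eventually_elim (auto simp: indicator_def)

text \<open>Brings the Hardy inequality into Poincare shape, with the killed norm on the left and
  the energy over the whole line on the right.\<close>

lemma hardy_inequality_iff_killed:
  "hardy_inequality S m a A \<longleftrightarrow> (\<forall>f\<in>killed_domain S m a.
     (\<integral>\<^sup>+x\<in>{a<..}. ennreal ((f x)\<^sup>2) \<partial>m)
     \<le> A * (\<integral>\<^sup>+x. ennreal ((scale_derivative S f x)\<^sup>2) \<partial>interval_measure S))"
proof (intro iffI ballI)
  fix f assume "hardy_inequality S m a A" and f: "f \<in> killed_domain S m a"
  then have "(\<integral>\<^sup>+x\<in>{a<..}. ennreal ((f x - f a)\<^sup>2) \<partial>m)
     \<le> A * (\<integral>\<^sup>+x\<in>{a<..}. ennreal ((scale_derivative S f x)\<^sup>2) \<partial>interval_measure S)"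
    by (auto simp: hardy_inequality_def killed_domain_def)
  also have "\<dots> \<le> A * (\<integral>\<^sup>+x. ennreal ((scale_derivative S f x)\<^sup>2) \<partial>interval_measure S)"
    by (intro mult_left_mono nn_integral_mono) (auto simp: indicator_def)
  finally show "(\<integral>\<^sup>+x\<in>{a<..}. ennreal ((f x)\<^sup>2) \<partial>m)
     \<le> A * (\<integral>\<^sup>+x. ennreal ((scale_derivative S f x)\<^sup>2) \<partial>interval_measure S)"
    using f by (simp add: killed_domain_def)
next
  assume R: "\<forall>f\<in>killed_domain S m a. (\<integral>\<^sup>+x\<in>{a<..}. ennreal ((f x)\<^sup>2) \<partial>m)
     \<le> A * (\<integral>\<^sup>+x. ennreal ((scale_derivative S f x)\<^sup>2) \<partial>interval_measure S)"
  show "hardy_inequality S m a A"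
    unfolding hardy_inequality_def
  proof
    fix F assume F: "F \<in> form_domain S m"
    let ?G = "\<lambda>x. F (max a x) - F a"
    have "(\<integral>\<^sup>+x\<in>{a<..}. ennreal ((F x - F a)\<^sup>2) \<partial>m) = (\<integral>\<^sup>+x\<in>{a<..}. ennreal ((?G x)\<^sup>2) \<partial>m)"
      by (intro nn_integral_cong) (auto simp: indicator_def)
    also have "\<dots> \<le> A * (\<integral>\<^sup>+x. ennreal ((scale_derivative S ?G x)\<^sup>2) \<partial>interval_measure S)"
      using R[rule_format, OF cut_in_killed_domain[OF F]] by simp
    also have "(\<integral>\<^sup>+x. ennreal ((scale_derivative S ?G x)\<^sup>2) \<partial>interval_measure S)
        = (\<integral>\<^sup>+x\<in>{a<..}. ennreal ((scale_derivative S F x)\<^sup>2) \<partial>interval_measure S)"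
      using scale_derivative_cut_AE[OF F]
      by (intro nn_integral_cong_AE) (auto elim!: eventually_mono simp: indicator_def)
    finally show "(\<integral>\<^sup>+x\<in>{a<..}. ennreal ((F x - F a)\<^sup>2) \<partial>m)
     \<le> A * (\<integral>\<^sup>+x\<in>{a<..}. ennreal ((scale_derivative S F x)\<^sup>2) \<partial>interval_measure S)" .
  qed
qed

text \<open>With the norm identity that follows, this links the real integrals of the gap to the
  Hardy integrals in [0,oo]. Integrability matters: a divergent Bochner integral would be 0 instead
  of infinity.\<close>

lemma ennreal_dirichlet_form:
  assumes "f \<in> killed_domain S m a"
  shows "ennreal (dirichlet_form S f f) = (\<integral>\<^sup>+x. ennreal ((scale_derivative S f x)\<^sup>2) \<partial>interval_measure S)"
  using assms form_domainD(5)[of f]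
  by (auto simp: dirichlet_form_def killed_domain_def nn_integral_eq_integral power2_eq_square)

lemma ennreal_killed_norm:
  assumes "f \<in> killed_domain S m a"
  shows "ennreal (\<integral>x. (f x)\<^sup>2 \<partial>killed_measure m a) = (\<integral>\<^sup>+x\<in>{a<..}. ennreal ((f x)\<^sup>2) \<partial>m)"
proof -
  have f: "f \<in> form_domain S m" using assms by (simp add: killed_domain_def)
  note D = form_domainD(2,3)[OF f]
  note [measurable] = D(1)
  have eq: "(\<integral>\<^sup>+x. ennreal ((f x)\<^sup>2) \<partial>killed_measure m a) = (\<integral>\<^sup>+x\<in>{a<..}. ennreal ((f x)\<^sup>2) \<partial>m)"
    unfolding killed_measure_def by (subst nn_integral_density) (auto simp: mult.commute)
  have "(\<integral>\<^sup>+x\<in>{a<..}. ennreal ((f x)\<^sup>2) \<partial>m) \<le> (\<integral>\<^sup>+x. ennreal ((f x)\<^sup>2) \<partial>m)"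
    by (intro nn_integral_mono) (auto simp: indicator_def)
  also have "\<dots> < \<infinity>" using D(2) by (simp add: nn_integral_eq_integral)
  finally have "integrable (killed_measure m a) (\<lambda>x. (f x)\<^sup>2)"
    unfolding eq[symmetric] by (intro integrableI_bounded) (simp_all add: killed_measure_def)
  then show ?thesis by (simp add: nn_integral_eq_integral flip: eq)
qed

lemma zero_in_killed_domain: "(\<lambda>_. 0) \<in> killed_domain S m a"
  using form_domainI[OF has_scale_derivative_zero, of m] by (simp add: killed_domain_def L2_def)

text \<open>Pairing a kernel element with itself gives zero energy, hence a constant function, which
  is 0 at the points below a. The projection in the gap is therefore 0.\<close>

lemma killed_generator_kernel:
  "generator_kernel (killed_measure m a) (killed_domain S m a) (dirichlet_form S) = {\<lambda>_. 0}"
proof (intro equalityI subsetI)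
  fix f assume "f \<in> generator_kernel (killed_measure m a) (killed_domain S m a) (dirichlet_form S)"
  then have f: "f \<in> killed_domain S m a" and "dirichlet_form S f f = 0"
    by (auto simp: generator_kernel_def form_generator_def)
  have F: "f \<in> form_domain S m" using f by (simp add: killed_domain_def)
  have "AE x in interval_measure S. scale_derivative S f x = 0"
    using \<open>dirichlet_form S f f = 0\<close> integral_nonneg_eq_0_iff_AE[OF form_domainD(5)[OF F]]
    by (simp add: dirichlet_form_def power2_eq_square)
  then have "AE x in interval_measure S. indicator {u..v} x *\<^sub>R scale_derivative S f x = 0" for u v
    by eventually_elim simp
  then have "(LINT x:{u..v}|interval_measure S. scale_derivative S f x) = 0" for u v
    unfolding set_lebesgue_integral_def by (rule integral_eq_zero_AE)
  then have const: "f v = f u" if "u \<le> v" for u v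
    using integral_Icc[OF form_domainD(1)[OF F] that] by simp
  have "f x = 0" for x
    using f const[of "min x a" x] by (simp add: killed_domain_def)
  then show "f \<in> {\<lambda>_. 0}" by auto
next
  fix f :: "real \<Rightarrow> real" assume "f \<in> {\<lambda>_. 0}"
  then have f: "f = (\<lambda>_. 0)" by simp
  \<comment> \<open>The derivative picked for the zero function is known to be 0 only almost
    everywhere.\<close>
  have "dirichlet_form S (\<lambda>_. 0) h = 0" for h
    unfolding dirichlet_form_def
    by (rule integral_eq_zero_AE)
      (use scale_derivative_eq_AE[OF has_scale_derivative_zero] in \<open>eventually_elim, simp\<close>)
  then show "f \<in> generator_kernel (killed_measure m a) (killed_domain S m a) (dirichlet_form S)"
    using zero_in_killed_domain
    by (simp add: f generator_kernel_def form_generator_def L2_def)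
qed

text \<open>As the kernel contains only 0, the projection must be p = 0, and a Poincare inequality
  on the killed domain remains.\<close>

lemma killed_spectral_gap_iff:
  "spectral_gap_at_least (killed_measure m a) (killed_domain S m a) (dirichlet_form S) \<gamma>
    \<longleftrightarrow> \<gamma> > 0 \<and> hardy_inequality S m a (ennreal (1 / \<gamma>))"
proof -
  have "\<gamma> * (\<integral>x. (f x)\<^sup>2 \<partial>killed_measure m a) \<le> dirichlet_form S f f \<longleftrightarrow>
      (\<integral>\<^sup>+x\<in>{a<..}. ennreal ((f x)\<^sup>2) \<partial>m)
     \<le> ennreal (1 / \<gamma>) * (\<integral>\<^sup>+x. ennreal ((scale_derivative S f x)\<^sup>2) \<partial>interval_measure S)"
    if "\<gamma> > 0" "f \<in> killed_domain S m a" for f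
  proof -
    \<comment> \<open>\<open>ennreal\<close> sends all negative reals to 0; a nonnegative energy
      makes the comparison in [0,oo] faithful.\<close>
    have "0 \<le> dirichlet_form S f f" by (simp add: dirichlet_form_def)
    then have "\<gamma> * (\<integral>x. (f x)\<^sup>2 \<partial>killed_measure m a) \<le> dirichlet_form S f f \<longleftrightarrow>
      ennreal \<gamma> * ennreal (\<integral>x. (f x)\<^sup>2 \<partial>killed_measure m a) \<le> ennreal (dirichlet_form S f f)"
      using that(1) by (simp flip: ennreal_mult add: ennreal_le_iff)
    then show ?thesis
      using ennreal_mult_le_iff_le_inverse_mult[OF that(1)] ennreal_dirichlet_form[OF that(2)]
        ennreal_killed_norm[OF that(2)] by simp
  qed
  then show ?thesis
    by (auto simp: spectral_gap_at_least_def killed_generator_kernel is_orthogonal_projection_def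
        hardy_inequality_iff_killed)
qed

text \<open>The infimum is attained: for fixed f with energy J > 0 and left side I, the inequality
  says A \<ge> I / J, a condition that passes to infima.\<close>

lemma hardy_inequality_hardy_constant:
  assumes "hardy_constant S m a < \<infinity>"
  shows "hardy_inequality S m a (hardy_constant S m a)"
  unfolding hardy_inequality_iff_killed
proof
  fix f assume f: "f \<in> killed_domain S m a"
  let ?I = "\<integral>\<^sup>+x\<in>{a<..}. ennreal ((f x)\<^sup>2) \<partial>m"
  let ?J = "\<integral>\<^sup>+x. ennreal ((scale_derivative S f x)\<^sup>2) \<partial>interval_measure S"
  have le: "?I \<le> A * ?J" if "hardy_inequality S m a A" for A
    using that f by (auto simp: hardy_inequality_iff_killed)
  have fin: "?J < \<infinity>" by (simp flip: ennreal_dirichlet_form[OF f])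
  show "?I \<le> hardy_constant S m a * ?J"
  proof (cases "?J = 0")
    case True
    \<comment> \<open>With zero energy, any admissible A forces the left side to be 0, as A * 0 = 0
      in [0,oo].\<close>
    obtain A where "hardy_inequality S m a A"
      using assms by (auto simp: hardy_constant_def Inf_less_iff)
    with le True show ?thesis by fastforce
  next
    case False
    have "?I / ?J \<le> hardy_constant S m a"
      unfolding hardy_constant_def using le False
      by (intro Inf_greatest divide_le_posI_ennreal) (auto simp: mult.commute zero_less_iff_neq_zero)
    then have "?I / ?J * ?J \<le> hardy_constant S m a * ?J" by (rule mult_right_mono) simp
    then show ?thesis using False fin by (simp add: ennreal_divide_times ennreal_divide_self)
  qed
qed

lemma not_hardy_inequality_zero: "\<not> hardy_inequality S m a 0"
proof
  assume hardy: "hardy_inequality S m a 0"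
  \<comment> \<open>The ramp is 0 up to a, S - S a on [a,a+1] and constant beyond: bounded, of
    finite energy and strictly positive to the right of a.\<close>
  define F where "F x = S (min (a + 1) (max a x)) - S a" for x
  have less: "S u \<le> S v \<longleftrightarrow> u \<le> v" "S u < S v \<longleftrightarrow> u < v" for u v
    using strict_mono_S by (simp_all add: strict_mono_less_eq strict_mono_less)
  have [measurable]: "S \<in> borel_measurable borel"
    using continuous_S by (rule borel_measurable_continuous_onI)
  have [measurable]: "F \<in> borel_measurable borel" unfolding F_def by measurable
  have deriv: "has_scale_derivative S F (\<lambda>x. indicator {a..} x * (indicator {..a + 1} x * 1))"
    using has_scale_derivative_cut_below[OF has_scale_derivative_cut_above[OF has_scale_derivative_self, of "a + 1"], of a]
    by (simp add: F_def[abs_def])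
  have "F \<in> L2 m"
    unfolding L2_def
  proof (intro CollectI conjI)
    have "integrable m (\<lambda>x. indicator {a..} x * (S (a + 1) - S a)\<^sup>2)"
      using finite_right by (intro integrable_mult_left) auto
    then show "integrable m (\<lambda>x. (F x)\<^sup>2)"
      by (rule Bochner_Integration.integrable_bound)
        (auto simp: F_def indicator_def less intro!: power_mono)
  qed measurable
  moreover have "integrable (interval_measure S) (\<lambda>x. (indicator {a..} x * (indicator {..a + 1} x * (1::real)))\<^sup>2)"
  proof -
    have "integrable (interval_measure S) (indicator {a..a + 1} :: real \<Rightarrow> real)"
      by (simp add: emeasure_Icc)
    also have "(indicator {a..a + 1} :: real \<Rightarrow> real) = (\<lambda>x. (indicator {a..} x * (indicator {..a + 1} x * 1))\<^sup>2)"
      by (auto simp: indicator_def)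
    finally show ?thesis .
  qed
  ultimately have "F \<in> form_domain S m" using deriv by (intro form_domainI)
  with hardy have "(\<integral>\<^sup>+x\<in>{a<..}. ennreal ((F x - F a)\<^sup>2) \<partial>m) = 0"
    by (auto simp: hardy_inequality_def)
  then have "AE x in m. ennreal ((F x - F a)\<^sup>2) * indicator {a<..} x = 0"
    by (subst (asm) nn_integral_0_iff_AE) auto
  then have "AE x in m. x \<notin> {a<..}"
  proof eventually_elim
    fix x assume eq: "ennreal ((F x - F a)\<^sup>2) * indicator {a<..} x = 0"
    have "F a < F x" if "a < x" using that by (simp add: F_def less)
    with eq show "x \<notin> {a<..}" by auto
  qed
  then have "emeasure m {a<..} = 0"
    using sets_eq_imp_space_eq[OF sets_m] by (subst (asm) AE_iff_measurable[OF _ refl]) (auto simp: greaterThan_def)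
  with charges_right show False by simp
qed

text \<open>Admissible gaps are the reciprocals of positive finite Hardy constants, so the smallest
  of these, being attained, gives the largest gap.\<close>

lemma is_spectral_gap_killed:
  assumes "hardy_constant S m a < \<infinity>"
  shows "is_spectral_gap (killed_measure m a) (killed_domain S m a) (dirichlet_form S)
    (1 / enn2real (hardy_constant S m a))"
proof -
  obtain r where r: "0 \<le> r" "hardy_constant S m a = ennreal r"
    using assms by (cases "hardy_constant S m a") auto
  \<comment> \<open>A zero infimum would itself be admissible, against the ramp; this keeps the
    convention 1 / 0 = 0 out of play.\<close>
  have "r \<noteq> 0"
    using hardy_inequality_hardy_constant[OF assms] not_hardy_inequality_zero r(2) by auto
  with r have "r > 0" by simp
  have "\<gamma> \<le> 1 / r" if "\<gamma> > 0" "hardy_inequality S m a (ennreal (1 / \<gamma>))" for \<gamma>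
  proof -
    have "ennreal r \<le> ennreal (1 / \<gamma>)"
      unfolding r(2)[symmetric] hardy_constant_def using that(2) by (intro Inf_lower) simp
    with that(1) \<open>r > 0\<close> show ?thesis by (simp add: field_simps)
  qed
  then show ?thesis
    using \<open>r > 0\<close> r hardy_inequality_hardy_constant[OF assms]
    by (auto simp: is_spectral_gap_def killed_spectral_gap_iff)
qed

text \<open>A finite best constant yields its reciprocal as gap, and a gap \<gamma> in turn makes 1
  / \<gamma> a Hardy constant. A largest admissible value is unique, which identifies
  \<gamma>.\<close>

lemma hardy_spectral_gap:
  defines "gap \<equiv> is_spectral_gap (killed_measure m a) (killed_domain S m a) (dirichlet_form S)"
  shows "((\<exists>\<gamma>. gap \<gamma>) \<longleftrightarrow> (\<exists>A. A < \<infinity> \<and> hardy_inequality S m a A))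
    \<and> ((\<exists>A. A < \<infinity> \<and> hardy_inequality S m a A) \<longleftrightarrow> hardy_constant S m a < \<infinity>)
    \<and> (\<forall>\<gamma>. gap \<gamma> \<longrightarrow> ennreal \<gamma> = 1 / hardy_constant S m a)"
proof -
  have hardy_iff: "(\<exists>A. A < \<infinity> \<and> hardy_inequality S m a A) \<longleftrightarrow> hardy_constant S m a < \<infinity>"
    by (auto simp: hardy_constant_def Inf_less_iff)
  have finite: "hardy_constant S m a < \<infinity>" if "gap \<gamma>" for \<gamma>
    using that unfolding hardy_iff[symmetric] gap_def is_spectral_gap_def killed_spectral_gap_iff
    by (auto intro!: exI[of _ "ennreal (1 / \<gamma>)"])
  have "ennreal \<gamma> = 1 / hardy_constant S m a" if "gap \<gamma>" for \<gamma>
  proof -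
    note gap' = is_spectral_gap_killed[OF finite[OF that]]
    with that have eq: "\<gamma> = 1 / enn2real (hardy_constant S m a)"
      by (intro antisym) (auto simp: gap_def is_spectral_gap_def)
    \<comment> \<open>Positivity of \<gamma> excludes a zero denominator, so the real quotient
      agrees with the one in [0,oo], where 1 / 0 is infinite.\<close>
    moreover have "\<gamma> > 0" using that by (simp add: gap_def is_spectral_gap_def spectral_gap_at_least_def)
    ultimately have "enn2real (hardy_constant S m a) > 0" by (simp add: zero_less_divide_iff)
    then show ?thesis
      using finite[OF that] divide_ennreal[of 1 "enn2real (hardy_constant S m a)"]
      by (simp add: eq)
  qed
  with hardy_iff finite is_spectral_gap_killed show ?thesis by (auto simp: gap_def)
qed

end

section \<open>Transfer of the analytic equivalence to the diffusion\<close>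

theorem proposition3p3:
  fixes M :: "'w measure" and F :: "ennreal \<Rightarrow> 'w measure"
    and P :: "real \<Rightarrow> 'w measure" and X :: "real \<Rightarrow> 'w \<Rightarrow> real"
    and S :: "real \<Rightarrow> real" and m :: "real measure" and a :: real
  assumes "positively_recurrent_diffusion M F P X"
    and "is_scale_function P X S"
    and "is_speed_measure P X S m"
  shows "((\<exists>\<gamma>. is_spectral_gap (killed_measure m a) (killed_domain S m a) (dirichlet_form S) \<gamma>)
            \<longleftrightarrow> (\<exists>A. A < \<infinity> \<and> hardy_inequality S m a A))
         \<and> ((\<exists>A. A < \<infinity> \<and> hardy_inequality S m a A) \<longleftrightarrow> hardy_constant S m a < \<infinity>)
         \<and> (\<forall>\<gamma>. is_spectral_gap (killed_measure m a) (killed_domain S m a) (dirichlet_form S) \<gamma>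
              \<longrightarrow> ennreal \<gamma> = 1 / hardy_constant S m a)"
proof -
  interpret positively_recurrent_diffusion M F P X by fact
  have sets: "sets m = sets borel" using assms(3) by (simp add: is_speed_measure_def)
  have "0 < emeasure m {a<..<a + 1}"
    using assms(3) by (rule speed_measure_charges_interval) simp
  also have "\<dots> \<le> emeasure m {a<..}"
    using sets by (intro emeasure_mono) auto
  finally interpret scale_speed S m a
    using assms(2) sets speed_measure_finite_right[OF assms(2,3)]
    by unfold_locales (auto simp: is_scale_function_def)
  show ?thesis by (rule hardy_spectral_gap)
qed

end
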